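(* Let $A\in\mathbb{R}^{m\times n}$ be a matrix of full column rank, let $b\in\mathbb{R}^{m}$, and let $x_{\star}=A^{\dagger}b$ be the minimum Euclidean norm least squares solution of $\min_{x\in\mathbb{R}^n}\|b-Ax\|_2^2$. Let $x_k$ be the $k$th approximation generated by the randomized Gauss--Seidel (RGS) method with (deterministic) initial guess $x_0\in\mathbb{R}^n$. Let $k\ge 0$ be such that $Ax_k\neq Ax_{\star}$ and $Ax_{k+1}\ne Ax_{\star}$ almost surely (so that the normalized vectors below are defined). Then $$\mathbb{E}\left[\left\langle \frac{Ax_k-Ax_{\star}}{\|Ax_k-Ax_{\star}\|_2},\frac{Ax_{k+1}-Ax_{\star}}{\|Ax_{k+1}-Ax_{\star}\|_2}\right\rangle^2\right]=1-\frac{1}{\|A\|_F^2}\,\mathbb{E}\left[\left\|A^T\frac{Ax_k-Ax_{\star}}{\|Ax_k-Ax_{\star}\|_2}\right\|_2^2\right].$$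
   Context: Notation: $A_{(j)}$ is the $j$th column of $A$, $e_{(j)}$ is the $j$th column of the $n\times n$ identity matrix, $\|A\|_F$ is the Frobenius norm, $A^{\dagger}$ is the Moore--Penrose pseudoinverse, $\langle\cdot,\cdot\rangle$ is the Euclidean inner product. RGS method: starting from $x_0\in\mathbb{R}^n$, for $k=1,2,\dots$, select an index $j\in\{1,\dots,n\}$, independently of the previous selections, with probability $\|A_{(j)}\|_2^2/\|A\|_F^2$, and set $$x_k=x_{k-1}-\frac{A_{(j)}^T(Ax_{k-1}-b)}{\|A_{(j)}\|_2^2}\,e_{(j)} .$$ $\mathbb{E}$ is the expectation over all random selections. *)

theory Defs
  imports "HOL-Probability.Probability"
begin

text \<open>The four Penrose conditions. A real matrix has exactly one matrix satisfying them;
  uniqueness, and existence for full column rank, are shown below.\<close>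

definition is_pseudoinverse :: "real^'n^'m \<Rightarrow> real^'m^'n \<Rightarrow> bool" where
  "is_pseudoinverse A X \<longleftrightarrow>
     A ** X ** A = A \<and> X ** A ** X = X \<and>
     transpose (A ** X) = A ** X \<and> transpose (X ** A) = X ** A"

definition pseudoinverse :: "real^'n^'m \<Rightarrow> real^'m^'n" where
  "pseudoinverse A = (THE X. is_pseudoinverse A X)"

text \<open>The selections are passed as a sequence \<open>j\<close>, the column used in step \<open>k \<ge> 1\<close> being
  \<open>j k\<close>; the value \<open>j 0\<close> is never used.\<close>

primrec rgs :: "real^'n^'m \<Rightarrow> real^'m \<Rightarrow> real^'n \<Rightarrow> (nat \<Rightarrow> 'n) \<Rightarrow> nat \<Rightarrow> real^'n" where
  "rgs A b x0 j 0 = x0"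
| "rgs A b x0 j (Suc k) =
     rgs A b x0 j k -
       (column (j (Suc k)) A \<bullet> (A *v rgs A b x0 j k - b) / (norm (column (j (Suc k)) A))\<^sup>2)
         *\<^sub>R axis (j (Suc k)) 1"

text \<open>The library norm on \<^typ>\<open>real^'n^'m\<close> is the Frobenius norm.\<close>

lemma norm_eq_frobenius:
  fixes A :: "real^'n^'m"
  shows "norm A = sqrt (\<Sum>i\<in>UNIV. \<Sum>j\<in>UNIV. (A $ i $ j)\<^sup>2)"
  by (simp add: norm_vec_def L2_set_def sum_nonneg)

lemma is_pseudoinverse_unique:
  assumes X: "is_pseudoinverse A X" and Y: "is_pseudoinverse A Y"
  shows "X = Y"
proof -
  note x = X[unfolded is_pseudoinverse_def] and y = Y[unfolded is_pseudoinverse_def]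
  have "A ** X = transpose (A ** Y ** A ** X)"
    using x y by simp
  also have "\<dots> = transpose (A ** X) ** transpose (A ** Y)"
    by (simp add: matrix_transpose_mul matrix_mul_assoc)
  also have "\<dots> = A ** Y"
    using x y by (simp add: matrix_mul_assoc)
  finally have AX: "A ** X = A ** Y" .
  have "X ** A = transpose (X ** (A ** Y ** A))"
    using x y by simp
  also have "\<dots> = transpose (Y ** A) ** transpose (X ** A)"
    by (simp add: matrix_transpose_mul matrix_mul_assoc)
  also have "\<dots> = Y ** (A ** X ** A)"
    by (metis x y matrix_mul_assoc)
  finally have XA: "X ** A = Y ** A"
    using x by simp
  have "X = X ** (A ** X)"
    using x by (simp add: matrix_mul_assoc)
  also have "\<dots> = Y ** A ** Y"
    by (simp add: AX XA matrix_mul_assoc)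
  finally show ?thesis
    using y by simp
qed

lemma is_pseudoinverse_full_column_rank:
  fixes A :: "real^'n^'m"
  assumes "rank A = CARD('n)"
  shows "is_pseudoinverse A (matrix_inv (transpose A ** A) ** transpose A)"
proof -
  define G where "G = transpose A ** A"
  have "x = 0" if "G *v x = 0" for x
  proof -
    have "(A *v x) \<bullet> (A *v x) = x \<bullet> (G *v x)"
      by (simp add: G_def dot_lmul_matrix flip: matrix_vector_mul_assoc)
         (metis dot_lmul_matrix inner_commute transpose_matrix_vector)
    with that have "A *v x = 0" by simp
    with assms show ?thesis
      using matrix_nonfull_linear_equations_eq by blast
  qed
  then have inv: "invertible G"
    by (simp add: invertible_left_inverse matrix_left_invertible_ker)
  then have l: "matrix_inv G ** G = mat 1" and r: "G ** matrix_inv G = mat 1"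
    unfolding matrix_inv_def invertible_def by (metis (mono_tags, lifting) someI_ex)+
  have tG: "transpose G = G"
    by (simp add: G_def matrix_transpose_mul)
  have "transpose (matrix_inv G) = transpose (matrix_inv G) ** (G ** matrix_inv G)"
    by (simp add: r)
  also have "\<dots> = transpose (G ** matrix_inv G) ** matrix_inv G"
    by (simp add: matrix_transpose_mul tG matrix_mul_assoc)
  finally have ti: "transpose (matrix_inv G) = matrix_inv G"
    by (simp add: r)
  have XA: "matrix_inv G ** transpose A ** A = mat 1"
    using l by (simp add: G_def matrix_mul_assoc)
  have "is_pseudoinverse A (matrix_inv G ** transpose A)"
    unfolding is_pseudoinverse_def
    by (metis XA matrix_mul_assoc matrix_mul_lid matrix_mul_rid matrix_transpose_mul ti
        transpose_mat transpose_transpose)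
  then show ?thesis by (simp add: G_def)
qed

lemma is_pseudoinverse_pseudoinverse:
  fixes A :: "real^'n^'m"
  assumes "rank A = CARD('n)"
  shows "is_pseudoinverse A (pseudoinverse A)"
  unfolding pseudoinverse_def
  using is_pseudoinverse_full_column_rank[OF assms] is_pseudoinverse_unique
  by (metis theI)

end

theory Submission
  imports Defs
begin

text \<open>
  Write \<open>r\<^sub>k = A x\<^sub>k - A x\<^sub>\<star>\<close>. By the normal equations \<open>A\<^sup>T (A x\<^sub>\<star> - b) = 0\<close>, the vector \<open>b\<close> in the
  update can be replaced by \<open>A x\<^sub>\<star>\<close>, so a step with column \<open>a\<close> of \<open>A\<close> turns \<open>r\<^sub>k\<close> into its
  orthogonal projection onto the complement of \<open>a\<close> (\<open>rgs_error_Suc\<close>). The squared cosine of the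
  angle between a vector and its projection is the quotient of their squared lengths, which here
  is \<open>1 - (a \<bullet> u\<^sub>k)\<^sup>2 / \<parallel>a\<parallel>\<^sup>2\<close> with \<open>u\<^sub>k = r\<^sub>k / \<parallel>r\<^sub>k\<parallel>\<close> (\<open>cos_sq_orthogonal_projection\<close>).

  It remains to average over the choice of \<open>a\<close>. The vector \<open>u\<^sub>k\<close> depends on the first \<open>k\<close>
  selections only, hence is independent of the next one, and the average may be taken over the
  columns for fixed \<open>u\<^sub>k\<close> (\<open>expectation_finite_sample\<close>). The sampling weights
  \<open>\<parallel>a\<parallel>\<^sup>2 / \<parallel>A\<parallel>\<^sub>F\<^sup>2\<close> cancel the denominators \<open>\<parallel>a\<parallel>\<^sup>2\<close>, and the sum of \<open>(a \<bullet> u\<^sub>k)\<^sup>2\<close> over all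
  columns is \<open>\<parallel>A\<^sup>T u\<^sub>k\<parallel>\<^sup>2\<close>.
\<close>

lemma column_nonzero_of_full_column_rank:
  fixes A :: "real^'n^'m"
  assumes "rank A = CARD('n)"
  shows "column j A \<noteq> 0"
proof
  assume "column j A = 0"
  then have "A *v axis j 1 = 0"
    by (simp add: matrix_vector_mul_component matrix_vector_mult_basis)
  then show False
    using assms matrix_nonfull_linear_equations_eq[of A] by (metis axis_eq_0_iff zero_neq_one)
qed

text \<open>The Penrose conditions \<open>A X A = A\<close> and \<open>(A X)\<^sup>T = A X\<close> combine to \<open>A\<^sup>T A X = A\<^sup>T\<close>.\<close>

lemma normal_equations_pseudoinverse:
  fixes A :: "real^'n^'m"
  assumes "rank A = CARD('n)"
  shows "transpose A *v (A *v (pseudoinverse A *v b)) = transpose A *v b"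
proof -
  let ?X = "pseudoinverse A"
  note P = is_pseudoinverse_pseudoinverse[OF assms, unfolded is_pseudoinverse_def]
  have "transpose A ** (A ** ?X) = transpose (A ** ?X ** A)"
    using P by (metis matrix_transpose_mul)
  also have "\<dots> = transpose A"
    using P by simp
  finally show ?thesis
    by (simp add: matrix_vector_mul_assoc matrix_mul_assoc)
qed

lemma transpose_mult_component:
  fixes A :: "real^'n^'m"
  shows "(transpose A *v v) $ j = column j A \<bullet> v"
  by (simp add: matrix_vector_mult_def transpose_def column_def inner_vec_def)

lemma norm_transpose_mult_sq:
  fixes A :: "real^'n^'m"
  shows "(norm (transpose A *v v))\<^sup>2 = (\<Sum>j\<in>UNIV. (column j A \<bullet> v)\<^sup>2)"
  unfolding norm_vec_def L2_set_def transpose_mult_component by (simp add: sum_nonneg)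

text \<open>One step projects the error \<open>A x - A x\<^sub>\<star>\<close> orthogonally to the selected column. This is what
  the normal equations are for: the update sees \<open>b\<close> only through its inner products with columns
  of \<open>A\<close>, where \<open>b\<close> and \<open>A x\<^sub>\<star>\<close> agree.\<close>

lemma rgs_error_Suc:
  fixes A :: "real^'n^'m" and x0 :: "real^'n" and j :: "nat \<Rightarrow> 'n" and k :: nat
  assumes normal_eq: "transpose A *v (A *v xstar) = transpose A *v b"
  defines "r \<equiv> \<lambda>l. A *v rgs A b x0 j l - A *v xstar" and "a \<equiv> column (j (Suc k)) A"
  shows "r (Suc k) = r k - (a \<bullet> r k / (norm a)\<^sup>2) *\<^sub>R a"
proof -
  have "a \<bullet> (A *v xstar) = a \<bullet> b"
    unfolding a_def by (metis normal_eq transpose_mult_component)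
  then show ?thesis
    by (simp add: r_def a_def matrix_vector_mult_diff_distrib scaleR_matrix_vector_assoc
        matrix_vector_mult_scaleR matrix_vector_mult_basis inner_diff_right)
qed

text \<open>If \<open>s\<close> is the projection of \<open>r\<close> then \<open>r \<bullet> s = \<parallel>s\<parallel>\<^sup>2\<close>, so the squared cosine is
  \<open>\<parallel>s\<parallel>\<^sup>2 / \<parallel>r\<parallel>\<^sup>2\<close>. With the convention \<open>0 / \<parallel>0\<parallel> = 0\<close> this includes \<open>s = 0\<close>.\<close>

lemma cos_sq_orthogonal_projection:
  fixes r a :: "'a::real_inner"
  assumes "r \<noteq> 0" and "a \<noteq> 0"
  defines "s \<equiv> r - (a \<bullet> r / (norm a)\<^sup>2) *\<^sub>R a"
  shows "((r /\<^sub>R norm r) \<bullet> (s /\<^sub>R norm s))\<^sup>2 = 1 - (a \<bullet> (r /\<^sub>R norm r))\<^sup>2 / (norm a)\<^sup>2"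
proof -
  have "a \<bullet> s = 0"
    using \<open>a \<noteq> 0\<close> by (simp add: s_def inner_diff_right power2_norm_eq_inner)
  then have rs: "r \<bullet> s = (norm s)\<^sup>2"
    unfolding power2_norm_eq_inner by (subst (2) s_def) (simp add: inner_diff_left)
  have "(norm s)\<^sup>2 = r \<bullet> r - (a \<bullet> r)\<^sup>2 / (norm a)\<^sup>2"
    by (subst rs[symmetric])
      (simp add: s_def inner_diff_right power2_eq_square inner_commute)
  then have s2: "(norm s)\<^sup>2 = (norm r)\<^sup>2 - (a \<bullet> r)\<^sup>2 / (norm a)\<^sup>2"
    by (simp add: power2_norm_eq_inner)
  have "((r /\<^sub>R norm r) \<bullet> (s /\<^sub>R norm s))\<^sup>2 = (norm s)\<^sup>2 / (norm r)\<^sup>2"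
    by (cases "s = 0") (simp_all add: rs field_simps power2_eq_square)
  also have "\<dots> = 1 - (a \<bullet> (r /\<^sub>R norm r))\<^sup>2 / (norm a)\<^sup>2"
    using assms(1,2) unfolding s2 by (simp add: field_simps power2_eq_square)
  finally show ?thesis .
qed

lemma borel_measurable_rgs:
  assumes "\<And>i. i \<in> {1..l} \<Longrightarrow> J i \<in> measurable M (count_space UNIV)"
  shows "(\<lambda>w. rgs A b x0 (\<lambda>i. J i w) l) \<in> borel_measurable M"
  using assms
proof (induction l)
  case (Suc l)
  have [measurable]: "(\<lambda>w. rgs A b x0 (\<lambda>i. J i w) l) \<in> borel_measurable M"
    using Suc by simp
  have [measurable]: "(*v) A \<in> borel_measurable borel"
    by (intro borel_measurable_continuous_onI matrix_vector_mult_linear_continuous_on)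
  have J: "J (Suc l) \<in> measurable M (count_space UNIV)"
    using Suc.prems by simp
  show ?case
    unfolding rgs.simps by (rule measurable_compose_countable[OF _ J]) measurable
qed simp

lemma rgs_cong:
  assumes "\<And>i. i \<in> {1..l} \<Longrightarrow> j i = j' i"
  shows "rgs A b x0 j l = rgs A b x0 j' l"
  using assms by (induction l) simp_all

text \<open>Conditioning on the value of an independent sample with finitely many values, phrased without
  conditional expectations: split along \<open>h X = i\<close> and factor each summand by independence. The two
  sides of \<^const>\<open>prob_space.indep_var\<close> have values in one type, so a sample of another type enters as a
  function \<open>h\<close> of such a variable.\<close>

lemma (in prob_space) expectation_finite_sample:
  fixes h :: "'b \<Rightarrow> 'i::finite" and f :: "'i \<Rightarrow> 'b \<Rightarrow> real"
  assumes indep: "indep_var P X N Y"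
    and h: "h \<in> measurable P (count_space UNIV)"
    and meas: "\<And>i. f i \<in> borel_measurable N"
    and int: "\<And>i. integrable M (\<lambda>w. f i (Y w))"
  shows "integrable M (\<lambda>w. f (h (X w)) (Y w))"
    and "expectation (\<lambda>w. f (h (X w)) (Y w)) =
      (\<Sum>i\<in>UNIV. prob {w \<in> space M. h (X w) = i} * expectation (\<lambda>w. f i (Y w)))"
proof -
  define g where "g i w = indicator {i} (h (X w)) * f i (Y w)" for i w
  have f_eq: "f (h (X w)) (Y w) = (\<Sum>i\<in>UNIV. g i w)" for w
  proof -
    have "(\<Sum>i\<in>UNIV. g i w) = (\<Sum>i\<in>UNIV. if i = h (X w) then f i (Y w) else 0)"
      by (intro sum.cong) (auto simp: g_def indicator_def)
    then show ?thesis by simp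
  qed
  have hX: "(\<lambda>w. h (X w)) \<in> measurable M (count_space UNIV)"
    using indep_var_rv1[OF indep] h by (rule measurable_compose)
  have ind_int: "integrable M (\<lambda>w. indicator {i} (h (X w)) :: real)" for i
    by (rule integrable_const_bound[where B = 1])
      (auto simp: indicator_def intro!: measurable_compose[OF hX])
  have ind: "indep_var borel (\<lambda>w. indicator {i} (h (X w)) :: real) borel (\<lambda>w. f i (Y w))" for i
  proof -
    have "(\<lambda>x. indicator {i} (h x) :: real) \<in> borel_measurable P"
      by (rule measurable_compose[OF h]) simp
    from indep_var_compose[OF indep this meas] show ?thesis
      by (simp add: comp_def)
  qed
  have g_int: "integrable M (g i)" for i
    unfolding g_def by (rule indep_var_integrable[OF ind ind_int int])
  have g_exp: "expectation (g i) = prob {w \<in> space M. h (X w) = i} * expectation (\<lambda>w. f i (Y w))" for i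
  proof -
    have "expectation (\<lambda>w. indicator {i} (h (X w))) =
        expectation (indicator {w \<in> space M. h (X w) = i} :: 'a \<Rightarrow> real)"
      by (intro Bochner_Integration.integral_cong) (auto simp: indicator_def)
    also have "\<dots> = prob {w \<in> space M. h (X w) = i}"
      by (simp add: Int_def conj_commute cong: conj_cong)
    finally show ?thesis
      unfolding g_def by (subst indep_var_lebesgue_integral[OF ind ind_int int]) simp
  qed
  show "integrable M (\<lambda>w. f (h (X w)) (Y w))"
    unfolding f_eq by (intro Bochner_Integration.integrable_sum g_int)
  show "expectation (\<lambda>w. f (h (X w)) (Y w)) =
      (\<Sum>i\<in>UNIV. prob {w \<in> space M. h (X w) = i} * expectation (\<lambda>w. f i (Y w)))"
    unfolding f_eq by (simp add: Bochner_Integration.integral_sum g_int g_exp)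
qed

theorem theorem4:
  fixes A :: "real^'n^'m" and b :: "real^'m" and x0 xstar :: "real^'n"
    and M :: "'w measure" and J :: "nat \<Rightarrow> 'w \<Rightarrow> 'n"
    and x :: "nat \<Rightarrow> 'w \<Rightarrow> real^'n" and k :: nat
  assumes full_column_rank: "rank A = CARD('n)"
    and xstar: "xstar = pseudoinverse A *v b"
    and prob: "prob_space M"
    and indep: "prob_space.indep_vars M (\<lambda>_. count_space UNIV) J {1..}"
    and distr: "\<And>l j. l \<ge> 1 \<Longrightarrow>
      measure M {w \<in> space M. J l w = j} = (norm (column j A))\<^sup>2 / (norm A)\<^sup>2"
    and x: "\<And>l w. x l w = rgs A b x0 (\<lambda>i. J i w) l"
    and ne_k: "AE w in M. A *v x k w \<noteq> A *v xstar"
    and ne_Suc_k: "AE w in M. A *v x (Suc k) w \<noteq> A *v xstar"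
  shows "(LINT w|M.
      (((A *v x k w - A *v xstar) /\<^sub>R norm (A *v x k w - A *v xstar)) \<bullet>
       ((A *v x (Suc k) w - A *v xstar) /\<^sub>R norm (A *v x (Suc k) w - A *v xstar)))\<^sup>2)
    = 1 - 1 / (norm A)\<^sup>2 *
      (LINT w|M. (norm (transpose A *v
        ((A *v x k w - A *v xstar) /\<^sub>R norm (A *v x k w - A *v xstar))))\<^sup>2)"
proof -
  interpret prob_space M by (rule prob)
  have col: "column j A \<noteq> 0" for j
    using full_column_rank by (rule column_nonzero_of_full_column_rank)
  have normal_eq: "transpose A *v (A *v xstar) = transpose A *v b"
    unfolding xstar using full_column_rank by (rule normal_equations_pseudoinverse)

  \<comment> \<open>\<open>Y\<close> is the history of the first \<open>k\<close> selections, \<open>u\<close> the normalized error as a function of the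
    history, and \<open>f j\<close> what is missing from a squared cosine of 1 if column \<open>j\<close> comes next.\<close>
  define N where "N = (\<Pi>\<^sub>M i\<in>{1..k}. count_space (UNIV :: 'n set))"
  define Y where "Y w = restrict (\<lambda>i. J i w) {1..k}" for w
  define u where
    "u y = (A *v rgs A b x0 y k - A *v xstar) /\<^sub>R norm (A *v rgs A b x0 y k - A *v xstar)" for y
  define f where "f j y = (column j A \<bullet> u y)\<^sup>2 / (norm (column j A))\<^sup>2" for j y

  have "rgs A b x0 (Y w) k = x k w" for w
    unfolding x Y_def by (rule rgs_cong) simp
  then have u_Y: "u (Y w) = (A *v x k w - A *v xstar) /\<^sub>R norm (A *v x k w - A *v xstar)" for w
    by (simp add: u_def)

  have indep_next: "indep_var (\<Pi>\<^sub>M i\<in>{Suc k}. count_space UNIV)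
      (\<lambda>w. restrict (\<lambda>i. J i w) {Suc k}) N Y"
    unfolding N_def Y_def by (rule indep_var_restrict[OF indep]) auto
  have next_meas: "(\<lambda>y. y (Suc k)) \<in>
      measurable (\<Pi>\<^sub>M i\<in>{Suc k}. count_space UNIV) (count_space (UNIV :: 'n set))"
    by (rule measurable_component_singleton) simp

  have [measurable]: "(*v) A \<in> borel_measurable borel"
    by (intro borel_measurable_continuous_onI matrix_vector_mult_linear_continuous_on)
  have "(\<lambda>y. rgs A b x0 y k) \<in> borel_measurable N"
    unfolding N_def
    by (rule borel_measurable_rgs[where J = "\<lambda>i y. y i"]) (rule measurable_component_singleton)
  then have f_meas: "f j \<in> borel_measurable N" for j
    unfolding f_def u_def by measurable
  \<comment> \<open>Since \<open>\<parallel>u y\<parallel> \<le> 1\<close>, Cauchy--Schwarz bounds \<open>f\<close>, which makes every expectation below finite.\<close>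
  have f_le: "f j y \<le> 1" for j y
  proof -
    have "\<bar>column j A \<bullet> u y\<bar> \<le> norm (column j A) * norm (u y)"
      by (rule Cauchy_Schwarz_ineq2)
    also have "\<dots> \<le> norm (column j A) * 1"
      by (rule mult_left_mono) (simp_all add: u_def divide_inverse_commute[symmetric])
    finally have "(column j A \<bullet> u y)\<^sup>2 \<le> (norm (column j A))\<^sup>2"
      by (simp add: abs_le_square_iff[symmetric])
    then show ?thesis
      using col[of j] by (simp add: f_def)
  qed
  have f_int: "integrable M (\<lambda>w. f j (Y w))" for j
    using f_le by (intro integrable_const_bound[where B = 1]
        measurable_compose[OF indep_var_rv2[OF indep_next] f_meas]) (auto simp: f_def)
  note sample = expectation_finite_sample[where f = f,
      OF indep_next next_meas f_meas f_int, simplified]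

  have step: "AE w in M.
      (((A *v x k w - A *v xstar) /\<^sub>R norm (A *v x k w - A *v xstar)) \<bullet>
       ((A *v x (Suc k) w - A *v xstar) /\<^sub>R norm (A *v x (Suc k) w - A *v xstar)))\<^sup>2
      = 1 - f (J (Suc k) w) (Y w)"
    using ne_k
  proof eventually_elim
    case (elim w)
    then have "A *v x k w - A *v xstar \<noteq> 0"
      by simp
    from cos_sq_orthogonal_projection[OF this col[of "J (Suc k) w"]] show ?case
      unfolding f_def u_Y x[of "Suc k" w] rgs_error_Suc[OF normal_eq] x[of k w, symmetric] .
  qed
  have "J i \<in> measurable M (count_space UNIV)" if "i \<in> {1..}" for i
    using indep that unfolding indep_vars_def2 by blast
  then have [measurable]: "x l \<in> borel_measurable M" for l
    unfolding x by (intro borel_measurable_rgs) simp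
  have "(LINT w|M.
      (((A *v x k w - A *v xstar) /\<^sub>R norm (A *v x k w - A *v xstar)) \<bullet>
       ((A *v x (Suc k) w - A *v xstar) /\<^sub>R norm (A *v x (Suc k) w - A *v xstar)))\<^sup>2)
      = expectation (\<lambda>w. 1 - f (J (Suc k) w) (Y w))"
  proof (rule integral_cong_AE[OF _ _ step])
    show "(\<lambda>w. 1 - f (J (Suc k) w) (Y w)) \<in> borel_measurable M"
      using sample(1) by (intro borel_measurable_diff borel_measurable_const
          borel_measurable_integrable)
  qed measurable
  also have "\<dots> = 1 - expectation (\<lambda>w. f (J (Suc k) w) (Y w))"
    using sample(1) by (simp add: prob_space)
  also have "expectation (\<lambda>w. f (J (Suc k) w) (Y w)) =
      (\<Sum>j\<in>UNIV. (norm (column j A))\<^sup>2 / (norm A)\<^sup>2 * expectation (\<lambda>w. f j (Y w)))"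
    unfolding sample(2) by (simp add: distr)
  also have "\<dots> = (\<Sum>j\<in>UNIV. 1 / (norm A)\<^sup>2 * expectation (\<lambda>w. (norm (column j A))\<^sup>2 * f j (Y w)))"
    by simp
  also have "\<dots> = 1 / (norm A)\<^sup>2 *
      expectation (\<lambda>w. \<Sum>j\<in>UNIV. (norm (column j A))\<^sup>2 * f j (Y w))"
    by (subst Bochner_Integration.integral_sum) (simp_all add: f_int sum_distrib_left)
  also have "(\<lambda>w. \<Sum>j\<in>UNIV. (norm (column j A))\<^sup>2 * f j (Y w)) =
      (\<lambda>w. (norm (transpose A *v u (Y w)))\<^sup>2)"
    unfolding f_def norm_transpose_mult_sq using col by simp
  finally show ?thesis
    unfolding u_Y .
qed

end
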